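(* Let $N\ge1$ be an integer, let $a:[0,1]\to[0,+\infty)$ be continuous and not identically zero on any subinterval of $[0,1]$, and let $f:[0,+\infty)\to[0,+\infty)$ be continuous with $f(s)>0$ for $s>0$. Assume that there exists a positive constant $\rho>0$ such that $\frac{f(s)}{s^N}\ge\rho$ for any $s>0$. Then there exists $\zeta_*>0$ such that the problem $$\left((u')^N\right)'=\lambda^NNr^{N-1}a(r)f(-u),\ r\in(0,1),\qquad u'(0)=u(1)=0,$$ has no convex solution for any $\lambda\in(\zeta_*,+\infty)$.
   Context: A solution is a function $u\in C^2[0,1]$ satisfying the problem; a convex solution means a nontrivial ($u\not\equiv0$) convex solution, i.e. one that is negative and strictly convex in $(0,1)$. *)

theory Defs
  imports "HOL-Analysis.Analysis"
begin

text \<open>\<open>u\<close> is of class $C^2$ on the closed interval with first and second derivatives \<open>u1\<close>, \<open>u2\<close>;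
  the derivatives at the endpoints are one-sided. \<open>u\<close> is only relevant on \<open>{0..1}\<close>.\<close>

definition C2_unit_interval ::
    "(real \<Rightarrow> real) \<Rightarrow> (real \<Rightarrow> real) \<Rightarrow> (real \<Rightarrow> real) \<Rightarrow> bool" where
  "C2_unit_interval u u1 u2 \<longleftrightarrow>
     (\<forall>r\<in>{0..1}. (u has_real_derivative u1 r) (at r within {0..1})) \<and>
     (\<forall>r\<in>{0..1}. (u1 has_real_derivative u2 r) (at r within {0..1})) \<and>
     continuous_on {0..1} u2"

definition is_solution ::
    "nat \<Rightarrow> (real \<Rightarrow> real) \<Rightarrow> (real \<Rightarrow> real) \<Rightarrow> real \<Rightarrow> (real \<Rightarrow> real) \<Rightarrow> bool" where
  "is_solution N a f lam u \<longleftrightarrow>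
     (\<exists>u1 u2. C2_unit_interval u u1 u2 \<and>
       (\<forall>r\<in>{0<..<1}. ((\<lambda>s. u1 s ^ N) has_real_derivative
           lam ^ N * real N * r ^ (N - 1) * a r * f (- u r)) (at r)) \<and>
       u1 0 = 0 \<and> u 1 = 0)"

text \<open>The nonlinearity \<open>f\<close> is only meaningful on \<open>{0..}\<close>. No separate sign condition on \<open>u\<close> is
  needed: a convex \<open>u\<close> whose derivative vanishes at \<open>0\<close> is nondecreasing, so \<open>u 1 = 0\<close> gives
  \<open>u \<le> 0\<close> on \<open>{0..1}\<close>. For \<open>a\<close> not identically zero on any subinterval and \<open>f > 0\<close> on \<open>{0<..}\<close>,
  nontrivial convex solutions (with \<open>lam > 0\<close>) are exactly the solutions that are negative and
  strictly convex in the open interval.\<close>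

definition is_convex_solution ::
    "nat \<Rightarrow> (real \<Rightarrow> real) \<Rightarrow> (real \<Rightarrow> real) \<Rightarrow> real \<Rightarrow> (real \<Rightarrow> real) \<Rightarrow> bool" where
  "is_convex_solution N a f lam u \<longleftrightarrow>
     is_solution N a f lam u \<and> convex_on {0..1} u \<and> (\<exists>r\<in>{0..1}. u r \<noteq> 0)"

end

theory Submission
  imports Defs
begin

text \<open>Fix \<open>0 < p < q < 1\<close> with \<open>a \<ge> m > 0\<close> on \<open>{p..q}\<close>. Convexity makes \<open>v = - u\<close> nonincreasing,
  positive at \<open>q\<close>, and gives \<open>u' q * (1 - q) \<le> v q\<close>. On the other hand the equation and
  \<open>f s \<ge> \<rho> * s ^ N\<close> force \<open>u' q ^ N\<close> to be at least a constant times \<open>(lam * v q) ^ N\<close>.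
  Cancelling \<open>v q ^ N\<close> bounds \<open>lam\<close>.\<close>

text \<open>The library's tangent inequality requires \<open>c\<close> to be interior; here \<open>c\<close> may be an endpoint.\<close>

lemma convex_on_above_tangent_within:
  fixes f :: "real \<Rightarrow> real"
  assumes conv: "convex_on A f" and c: "c \<in> A" and x: "x \<in> A"
    and der: "(f has_real_derivative D) (at c within A)"
  shows "f c + D * (x - c) \<le> f x"
proof -
  define g where "g = (\<lambda>t. c + t * (x - c))"
  have gA: "g ` {0..1} \<subseteq> A"
  proof
    fix y assume "y \<in> g ` {0..1}"
    then obtain t where "t \<in> {0..1}" "y = (1 - t) *\<^sub>R c + t *\<^sub>R x"
      by (auto simp: g_def algebra_simps)
    then show "y \<in> A"
      using convexD_alt[OF convex_on_imp_convex[OF conv] c x, of t] by simp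
  qed
  have "(f has_real_derivative D) (at (g 0) within g ` {0..1})"
    using DERIV_subset[OF der gA] by (simp add: g_def)
  moreover have "(g has_real_derivative x - c) (at 0 within {0..1})"
    unfolding g_def by (auto intro!: derivative_eq_intros)
  ultimately have "((f \<circ> g) has_real_derivative D * (x - c)) (at 0 within {0..1})"
    by (rule DERIV_image_chain)
  then have lim: "((\<lambda>t. (f (g t) - f c) / t) \<longlongrightarrow> D * (x - c)) (at 0 within {0..1})"
    by (simp add: has_field_derivative_iff g_def)
  \<comment> \<open>Convexity bounds every difference quotient by its value at \<open>t = 1\<close>;
    the bound survives the limit at 0.\<close>
  have "(f (g t) - f c) / t \<le> f x - f c" if t: "t \<in> {0..1}" "t \<noteq> 0" for t
  proof -
    have "f (g t) \<le> (1 - t) * f c + t * f x"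
      using convex_onD[OF conv, of t c x] t c x by (simp add: g_def algebra_simps)
    then show ?thesis
      using t by (simp add: divide_simps algebra_simps)
  qed
  then have "\<forall>\<^sub>F t in at 0 within {0..1}. (f (g t) - f c) / t \<le> f x - f c"
    by (auto simp: eventually_at_filter)
  moreover have "at (0::real) within {0..1} \<noteq> bot"
    by (simp add: at_within_Icc_at_right)
  ultimately have "D * (x - c) \<le> f x - f c"
    using lim tendsto_upperbound by blast
  then show ?thesis by simp
qed

lemma continuous_on_Icc_pos_lower_bound:
  fixes a :: "real \<Rightarrow> real"
  assumes cont: "continuous_on {c..d} a" and r: "r \<in> {c..d}" and pos: "a r > 0" and "c < d"
  obtains p q where "c \<le> p" "p < q" "q \<le> d" "\<forall>s\<in>{p..q}. a r / 2 \<le> a s"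
proof -
  from cont r pos obtain e where e: "e > 0" "\<And>s. s \<in> {c..d} \<Longrightarrow> dist s r < e \<Longrightarrow> dist (a s) (a r) < a r / 2"
    unfolding continuous_on_iff by (metis half_gt_zero)
  \<comment> \<open>Half the radius keeps the closed interval inside the open \<open>e\<close>-ball;
    clipping to \<open>{c..d}\<close> allows \<open>r\<close> to be an endpoint.\<close>
  define p where "p = max c (r - e / 2)"
  define q where "q = min d (r + e / 2)"
  have "a r / 2 \<le> a s" if "s \<in> {p..q}" for s
  proof -
    have "s \<in> {c..d}" "dist s r < e"
      using that e(1) by (auto simp: p_def q_def dist_real_def)
    from e(2)[OF this] show ?thesis unfolding dist_real_def by linarith
  qed
  moreover have "c \<le> p" "p < q" "q \<le> d"
    using r e(1) \<open>c < d\<close> by (auto simp: p_def q_def)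
  ultimately show ?thesis using that by blast
qed

text \<open>The factor of \<open>lam ^ N\<close> involves neither \<open>u\<close> nor
  \<open>lam\<close>, so one threshold serves all convex solutions.\<close>

lemma convex_solution_lam_bound:
  fixes a f u :: "real \<Rightarrow> real"
  assumes sol: "is_convex_solution N a f lam u" and "lam \<ge> 0"
    and pq: "0 < p" "p < q" "q < 1"
    and m: "m > 0" "\<forall>r\<in>{p..q}. m \<le> a r"
    and \<rho>: "\<rho> > 0" "\<forall>s>0. f s / s ^ N \<ge> \<rho>"
  shows "lam ^ N * ((q - p) * real N * p ^ (N - 1) * m * \<rho> * (1 - q) ^ N) \<le> 1"
proof -
  from sol obtain u1 u2 where C2: "C2_unit_interval u u1 u2"
    and ode: "\<And>r. r \<in> {0<..<1} \<Longrightarrow> ((\<lambda>s. u1 s ^ N) has_real_derivative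
           lam ^ N * real N * r ^ (N - 1) * a r * f (- u r)) (at r)"
    and bc: "u1 0 = 0" "u 1 = 0"
    and conv: "convex_on {0..1} u" and nontriv: "\<exists>r\<in>{0..1}. u r \<noteq> 0"
    unfolding is_convex_solution_def is_solution_def by blast
  have tangent: "u r + u1 r * (s - r) \<le> u s" if "r \<in> {0..1}" "s \<in> {0..1}" for r s
    using C2 that by (intro convex_on_above_tangent_within[OF conv]) (auto simp: C2_unit_interval_def)
  have min0: "u 0 \<le> u s" if "s \<in> {0..1}" for s
    using tangent[of 0 s] that bc by simp
  have u1_nonneg: "0 \<le> u1 r" if "r \<in> {0..1}" for r
  proof (cases "r = 0")
    case False
    \<comment> \<open>The tangent at \<open>r\<close>, evaluated at 0, lies below the minimum
      \<open>u 0\<close>, which is at most \<open>u r\<close>.\<close>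
    have "0 \<le> u1 r * r" using tangent[of r 0] min0[of r] that by simp
    then show ?thesis using False that by (simp add: zero_le_mult_iff)
  qed (use bc in simp)
  have mono: "u r \<le> u s" if "r \<in> {0..1}" "s \<in> {0..1}" "r \<le> s" for r s
    using tangent[of r s] mult_nonneg_nonneg[OF u1_nonneg[of r], of "s - r"] that by simp
  define v where "v = - u q"
  from nontriv have "u 0 < 0"
    using mono[of _ 1] min0 bc by fastforce
  \<comment> \<open>The chord from \<open>(0, u 0)\<close> to \<open>(1, 0)\<close> carries
    negativity from 0 to \<open>q\<close>.\<close>
  moreover have "u q \<le> (1 - q) * u 0"
    using convex_onD[OF conv, of q 0 1] pq bc by simp
  ultimately have v: "v > 0"
    using pq mult_pos_neg[of "1 - q" "u 0"] by (simp add: v_def)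
  \<comment> \<open>The mean value theorem replaces integrating the equation over
    \<open>{p..q}\<close>.\<close>
  obtain \<xi> where \<xi>: "p < \<xi>" "\<xi> < q"
    "u1 q ^ N - u1 p ^ N = (q - p) * (lam ^ N * real N * \<xi> ^ (N - 1) * a \<xi> * f (- u \<xi>))"
    using MVT2[of p q "\<lambda>s. u1 s ^ N" "\<lambda>r. lam ^ N * real N * r ^ (N - 1) * a r * f (- u r)"] ode pq
    by auto
  have v\<xi>: "v \<le> - u \<xi>" using mono[of \<xi> q] \<xi> pq by (simp add: v_def)
  have "\<rho> * v ^ N \<le> \<rho> * (- u \<xi>) ^ N"
    using v v\<xi> \<rho> by (intro mult_left_mono power_mono) auto
  also have "\<dots> \<le> f (- u \<xi>)"
    using \<rho>(2)[rule_format, of "- u \<xi>"] v v\<xi> by (simp add: pos_le_divide_eq)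
  finally have f_ge: "\<rho> * v ^ N \<le> f (- u \<xi>)" .
  have a\<xi>: "m \<le> a \<xi>" using m(2) \<xi> by simp
  have "(q - p) * (lam ^ N * real N * p ^ (N - 1) * m * (\<rho> * v ^ N))
      \<le> (q - p) * (lam ^ N * real N * \<xi> ^ (N - 1) * a \<xi> * f (- u \<xi>))"
    using pq \<xi>(1,2) m(1) a\<xi> v \<rho>(1) \<open>lam \<ge> 0\<close> f_ge
    by (intro mult_left_mono mult_mono power_mono mult_nonneg_nonneg) auto
  also have "\<dots> \<le> u1 q ^ N"
    using \<xi>(3) zero_le_power[OF u1_nonneg[of p], of N] pq by simp
  finally have lower: "(q - p) * (lam ^ N * real N * p ^ (N - 1) * m * (\<rho> * v ^ N)) \<le> u1 q ^ N" .
  \<comment> \<open>This is the tangent at \<open>q\<close> evaluated at 1, where \<open>u\<close>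
    vanishes.\<close>
  have "u1 q * (1 - q) \<le> v"
    using tangent[of q 1] pq bc by (simp add: v_def)
  then have upper: "(u1 q * (1 - q)) ^ N \<le> v ^ N"
    using u1_nonneg[of q] pq by (intro power_mono) auto
  have "lam ^ N * ((q - p) * real N * p ^ (N - 1) * m * \<rho> * (1 - q) ^ N) * v ^ N
      = (q - p) * (lam ^ N * real N * p ^ (N - 1) * m * (\<rho> * v ^ N)) * (1 - q) ^ N"
    by (simp add: algebra_simps)
  also have "\<dots> \<le> u1 q ^ N * (1 - q) ^ N"
    using lower pq by (intro mult_right_mono) auto
  also have "\<dots> \<le> 1 * v ^ N" using upper by (simp add: power_mult_distrib)
  finally show ?thesis using v by (simp only: mult_le_cancel_right_pos zero_less_power)
qed

theorem corollary5p1: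
  fixes N :: nat and a f :: "real \<Rightarrow> real" and \<rho> :: real
  assumes "N \<ge> 1"
    and "continuous_on {0..1} a"
    and "\<forall>r\<in>{0..1}. a r \<ge> 0"
    and "\<forall>c d. 0 \<le> c \<longrightarrow> c < d \<longrightarrow> d \<le> 1 \<longrightarrow> (\<exists>r\<in>{c..d}. a r \<noteq> 0)"
    and "continuous_on {0..} f"
    and "\<forall>s\<ge>0. f s \<ge> 0"
    and "\<forall>s>0. f s > 0"
    and "\<rho> > 0"
    and "\<forall>s>0. f s / s ^ N \<ge> \<rho>"
  shows "\<exists>\<zeta>>0. \<forall>lam>\<zeta>. \<not> (\<exists>u. is_convex_solution N a f lam u)"
proof -
  \<comment> \<open>Staying away from 0 and 1 keeps \<open>p\<close> and \<open>1 - q\<close>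
    positive, hence \<open>K > 0\<close> below.\<close>
  obtain r where r: "r \<in> {1/4..3/4}" "a r \<noteq> 0"
    using assms(4)[rule_format, of "1/4" "3/4"] by auto
  with assms(3) have ar: "a r > 0" by (simp add: order.strict_iff_order)
  obtain p q where pq: "1/4 \<le> p" "p < q" "q \<le> 3/4" "\<forall>s\<in>{p..q}. a r / 2 \<le> a s"
    using continuous_on_Icc_pos_lower_bound[of "1/4" "3/4" a r] r ar
      continuous_on_subset[OF assms(2), of "{1/4..3/4}"] by auto
  define K where "K = (q - p) * real N * p ^ (N - 1) * (a r / 2) * \<rho> * (1 - q) ^ N"
  have K: "K > 0"
    unfolding K_def using pq ar assms(1,8) by (intro mult_pos_pos zero_less_power) auto
  \<comment> \<open>The bound 1 yields \<open>lam \<le> lam ^ N\<close>, and \<open>1 / K\<close>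
    then yields \<open>lam ^ N * K > 1\<close>.\<close>
  have "\<not> is_convex_solution N a f lam u" if lam: "lam > max 1 (1 / K)" for lam u
  proof
    assume "is_convex_solution N a f lam u"
    then have "lam ^ N * K \<le> 1"
      unfolding K_def using lam pq ar assms(8,9) by (intro convex_solution_lam_bound) auto
    moreover have "lam \<le> lam ^ N"
      using lam assms(1) by (intro self_le_power) auto
    then have "lam * K \<le> lam ^ N * K"
      using K by simp
    moreover have "1 < lam * K"
      using lam K by (simp add: pos_divide_less_eq)
    ultimately show False by simp
  qed
  then show ?thesis
    by (intro exI[of _ "max 1 (1 / K)"]) auto
qed

end
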